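(* Let $P_{XY}$ be any joint distribution on finite alphabets $\mathcal{X}$ and $\mathcal{Y}$. Then: 1) $\mathcal{L}(X\to Y)=0$ if and only if $X$ and $Y$ are independent. 2) (Additivity) If $(X_i,Y_i)$, $i=1,\dots,n$, are mutually independent pairs (on finite alphabets), then $\mathcal{L}(X^n\to Y^n)=\sum_{i=1}^n\mathcal{L}(X_i\to Y_i)$. 3) Assuming $X$ has full support on $\mathcal{X}$, $\mathcal{L}(X\to Y)=\log|\mathcal{X}|$ if and only if $X$ is a deterministic function of $Y$. 4) $\mathcal{L}(X\to X)=H_0(X)=\log|\mathrm{supp}(X)|$. 5) $\mathcal{L}(X\to Y)$ is not symmetric in $X$ and $Y$; i.e., there exists a joint distribution with $\mathcal{L}(X\to Y)\ne\mathcal{L}(Y\to X)$. 6) $\exp\{\mathcal{L}(X\to Y)\}$ is convex in $P_{Y|X}$ for fixed support of $P_X$. 7) $\mathcal{L}(X\to Y)$ is concave in $P_X$ for fixed $P_{Y|X}$.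
   Context: $\log$ is the natural logarithm. Dashes denote Markov chains. The maximal leakage is $$\mathcal{L}(X\to Y)=\sup_{U-X-Y-\hat U}\log\frac{\Pr(U=\hat U)}{\max_{u\in\mathcal{U}}P_U(u)},$$ the supremum being over all $U,\hat U$ taking values in the same finite, but arbitrary, alphabet $\mathcal{U}$. $\mathrm{supp}(X)=\{x:P_X(x)>0\}$; $H_0$ is the Rényi entropy of order $0$, i.e. $\log|\mathrm{supp}(X)|$. $X^n=(X_1,\dots,X_n)$ and $Y^n=(Y_1,\dots,Y_n)$. *)

theory Defs
  imports "HOL-Probability.Probability"
begin

text \<open>
  Random variables are functions on a discrete probability space \<open>R :: 'w pmf\<close>. For
  finite-valued variables this is no restriction, since only their joint law matters.
\<close>

text \<open>Extended logarithm and exponential, with \<open>log 0 = -\<infinity>\<close> (whereas \<open>ln 0 = 0\<close>).\<close>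

definition ereal_ln :: "real \<Rightarrow> ereal" where
  "ereal_ln r = (if 0 < r then ereal (ln r) else -\<infinity>)"

definition ereal_exp :: "ereal \<Rightarrow> ereal" where
  "ereal_exp x =
     (if x = \<infinity> then \<infinity> else if x = -\<infinity> then 0 else ereal (exp (real_of_ereal x)))"

text \<open>
  \<open>A - B - C\<close>: conditioning on \<open>A\<close> in addition to \<open>B\<close> does not change the law of \<open>C\<close>. The guard
  excludes conditioning on null events.
\<close>

definition markov_chain :: "'w pmf \<Rightarrow> ('w \<Rightarrow> 'a) \<Rightarrow> ('w \<Rightarrow> 'b) \<Rightarrow> ('w \<Rightarrow> 'c) \<Rightarrow> bool" where
  "markov_chain R A B C \<longleftrightarrow>
     (\<forall>a b c. \<P>(\<omega> in measure_pmf R. A \<omega> = a \<and> B \<omega> = b) > 0 \<longrightarrow>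
        \<P>(\<omega> in measure_pmf R. C \<omega> = c \<bar> A \<omega> = a \<and> B \<omega> = b) = \<P>(\<omega> in measure_pmf R. C \<omega> = c \<bar> B \<omega> = b))"

definition markov_chain4 ::
  "'w pmf \<Rightarrow> ('w \<Rightarrow> 'a) \<Rightarrow> ('w \<Rightarrow> 'b) \<Rightarrow> ('w \<Rightarrow> 'c) \<Rightarrow> ('w \<Rightarrow> 'd) \<Rightarrow> bool" where
  "markov_chain4 R A B C D \<longleftrightarrow>
     markov_chain R A B C \<and> markov_chain R (\<lambda>\<omega>. (A \<omega>, B \<omega>)) C D"

text \<open>
  Maximal leakage \<open>\<L>(X \<rightarrow> Y)\<close>. The supremum ranges over all joint laws \<open>Q\<close> of a quadruple
  \<open>(U, X', Y', V)\<close> in which \<open>(X', Y')\<close> has the law of \<open>(X, Y)\<close> and \<open>V\<close> is the guess of \<open>U\<close>.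
  Taking the alphabet of \<open>U\<close> and \<open>V\<close> to be a finite set of natural numbers loses no
  generality, as every finite alphabet can be relabelled that way.
\<close>

definition leakage_candidates ::
  "('x \<times> 'y) pmf \<Rightarrow> (nat set \<times> (nat \<times> 'x \<times> 'y \<times> nat) pmf) set" where
  "leakage_candidates P =
     {(\<U>, Q). finite \<U> \<and> set_pmf Q \<subseteq> \<U> \<times> UNIV \<times> UNIV \<times> \<U> \<and>
        map_pmf (\<lambda>(u, x, y, v). (x, y)) Q = P \<and>
        markov_chain4 Q (\<lambda>(u, x, y, v). u) (\<lambda>(u, x, y, v). x)
          (\<lambda>(u, x, y, v). y) (\<lambda>(u, x, y, v). v)}"

definition maximal_leakage :: "'w pmf \<Rightarrow> ('w \<Rightarrow> 'x) \<Rightarrow> ('w \<Rightarrow> 'y) \<Rightarrow> ereal" where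
  "maximal_leakage R X Y =
     (SUP (\<U>, Q) \<in> leakage_candidates (map_pmf (\<lambda>\<omega>. (X \<omega>, Y \<omega>)) R).
        ereal_ln (\<P>((u, x, y, v) in measure_pmf Q. u = v) / (MAX u\<in>\<U>. pmf (map_pmf fst Q) u)))"

definition renyi_entropy_0 :: "'w pmf \<Rightarrow> ('w \<Rightarrow> 'x) \<Rightarrow> real" where
  "renyi_entropy_0 R X = ln (real (card (set_pmf (map_pmf X R))))"

text \<open>The joint law with input law \<open>p = P\<^sub>X\<close> and conditional law \<open>W x = P\<^sub>Y\<^sub>|\<^sub>X(\<cdot>|x)\<close>.\<close>

definition channel_joint :: "'x pmf \<Rightarrow> ('x \<Rightarrow> 'y pmf) \<Rightarrow> ('x \<times> 'y) pmf" where
  "channel_joint p W = bind_pmf p (\<lambda>x. map_pmf (Pair x) (W x))"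

text \<open>The convex combination \<open>t p + (1 - t) q\<close>, for \<open>0 \<le> t \<le> 1\<close>.\<close>

definition mix_pmf :: "real \<Rightarrow> 'a pmf \<Rightarrow> 'a pmf \<Rightarrow> 'a pmf" where
  "mix_pmf t p q = bind_pmf (bernoulli_pmf t) (\<lambda>b. if b then p else q)"

end

theory Submission
  imports Defs
begin

text \<open>
  Everything follows from \<open>\<L>(X \<rightarrow> Y) = log (\<Sum>\<^sub>y max\<^sub>x P(y | x))\<close>, where \<open>x\<close> ranges over the support
  of \<open>X\<close>. For the upper bound, \<open>P(u, x, y, v) \<le> P(u, x) M(y) P(v | y)\<close> with \<open>M(y) = max\<^sub>x P(y | x)\<close>.
  Summing over \<open>x\<close>, bounding \<open>P(u)\<close> by its maximum and summing over \<open>u = v\<close> and \<open>y\<close> gives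
  \<open>P(U = V) \<le> max\<^sub>u P(u) \<Sum>\<^sub>y M(y)\<close>. The bound is attained by a secret \<open>U\<close> that contains, for each
  \<open>x\<close>, a maximally likely value occurring only together with \<open>X = x\<close>.

  Since \<open>P\<^sub>Y(y) \<le> M(y) \<le> \<Sum>\<^sub>x P(y | x)\<close>, the sum of \<open>M\<close> lies between \<open>1\<close> and the size of the support,
  and the equality cases are independence and determinism. The sum is multiplicative over independent
  pairs, convex in the channel, and increasing in the support of \<open>P\<^sub>X\<close>.
\<close>

section \<open>Transition probabilities and the sum of their maxima\<close>

definition transition_prob :: "('x \<times> 'y) pmf \<Rightarrow> 'x \<Rightarrow> 'y \<Rightarrow> real" where
  "transition_prob P x y = pmf P (x, y) / pmf (map_pmf fst P) x"

definition max_transition :: "('x \<times> 'y) pmf \<Rightarrow> 'y \<Rightarrow> real" where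
  "max_transition P y = (MAX x\<in>fst ` set_pmf P. transition_prob P x y)"

text \<open>This is the exponential of Sibson's mutual information of order infinity. For fixed
  transition probabilities it depends on the first marginal only through its support, since
  \<open>max_transition\<close> ranges over that support.\<close>

definition leakage_sum :: "('x \<times> 'y) pmf \<Rightarrow> real" where
  "leakage_sum P = (\<Sum>y\<in>snd ` set_pmf P. max_transition P y)"

lemma transition_prob_nonneg: "0 \<le> transition_prob P x y"
  by (simp add: transition_prob_def)

text \<open>A zero denominator makes the quotient 0, which is harmless: an \<open>x\<close> of mass
  zero has joint mass zero with every \<open>y\<close>, so both sides vanish.\<close>

lemma pmf_eq_transition: "pmf P (x, y) = pmf (map_pmf fst P) x * transition_prob P x y"
proof (cases "pmf (map_pmf fst P) x = 0")
  case True
  then have "x \<notin> fst ` set_pmf P"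
    by (metis pmf_eq_0_set_pmf set_map_pmf)
  then have "pmf P (x, y) = 0"
    by (metis fst_conv image_eqI pmf_eq_0_set_pmf)
  then show ?thesis using True by simp
qed (simp add: transition_prob_def)

lemma transition_prob_le_max:
  assumes "finite (set_pmf P)" "x \<in> fst ` set_pmf P"
  shows "transition_prob P x y \<le> max_transition P y"
  unfolding max_transition_def using assms by (intro Max_ge) auto

lemma max_transition_attained:
  assumes "finite (set_pmf P)"
  obtains x where "x \<in> fst ` set_pmf P" "transition_prob P x y = max_transition P y"
proof -
  have "max_transition P y \<in> (\<lambda>x. transition_prob P x y) ` fst ` set_pmf P"
    unfolding max_transition_def using assms by (intro Max_in) (auto simp: set_pmf_not_empty)
  then show ?thesis using that by (metis imageE)
qed

lemma max_transition_nonneg: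
  assumes "finite (set_pmf P)"
  shows "0 \<le> max_transition P y"
  by (metis max_transition_attained[OF assms] transition_prob_nonneg)

text \<open>A value \<open>y\<close> of probability zero has zero transition probability from every
  \<open>x\<close>, so enlarging the index set adds only zero terms. This permits summation over a
  whole alphabet or over a product set.\<close>

lemma leakage_sum_superset:
  assumes "finite (set_pmf P)" "finite B" "snd ` set_pmf P \<subseteq> B"
  shows "leakage_sum P = (\<Sum>y\<in>B. max_transition P y)"
  unfolding leakage_sum_def
proof (rule sum.mono_neutral_left)
  show "\<forall>y\<in>B - snd ` set_pmf P. max_transition P y = 0"
  proof
    fix y assume y: "y \<in> B - snd ` set_pmf P"
    obtain x where x: "transition_prob P x y = max_transition P y"
      using max_transition_attained[OF assms(1)] by metis
    have "pmf P (x, y) = 0"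
      using y by (metis DiffD2 image_eqI pmf_eq_0_set_pmf snd_conv)
    with x show "max_transition P y = 0" by (simp add: transition_prob_def)
  qed
qed (use assms in auto)

lemma sum_pmf_pair_snd:
  assumes "finite (set_pmf P)"
  shows "(\<Sum>x\<in>fst ` set_pmf P. pmf P (x, y)) = pmf (map_pmf snd P) y"
proof -
  have "pmf (map_pmf snd P) y = measure (measure_pmf P) (snd -` {y})"
    by (simp add: pmf_map)
  also have "\<dots> = measure (measure_pmf P) ((\<lambda>x. (x, y)) ` fst ` set_pmf P)"
    by (rule measure_pmf.finite_measure_eq_AE) (force simp: AE_measure_pmf_iff)+
  also have "\<dots> = (\<Sum>x\<in>fst ` set_pmf P. pmf P (x, y))"
    using assms by (subst measure_measure_pmf_finite) (auto simp: sum.reindex inj_on_def)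
  finally show ?thesis by simp
qed

lemma sum_pmf_pair_fst:
  assumes "finite (set_pmf P)"
  shows "(\<Sum>y\<in>snd ` set_pmf P. pmf P (x, y)) = pmf (map_pmf fst P) x"
proof -
  have "pmf (map_pmf fst P) x = measure (measure_pmf P) (fst -` {x})"
    by (simp add: pmf_map)
  also have "\<dots> = measure (measure_pmf P) (Pair x ` snd ` set_pmf P)"
    by (rule measure_pmf.finite_measure_eq_AE) (force simp: AE_measure_pmf_iff)+
  also have "\<dots> = (\<Sum>y\<in>snd ` set_pmf P. pmf P (x, y))"
    using assms by (subst measure_measure_pmf_finite) (auto simp: sum.reindex inj_on_def)
  finally show ?thesis by simp
qed

lemma sum_transition_prob:
  assumes "finite (set_pmf P)" "x \<in> fst ` set_pmf P"
  shows "(\<Sum>y\<in>snd ` set_pmf P. transition_prob P x y) = 1"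
proof -
  have "pmf (map_pmf fst P) x \<noteq> 0"
    using assms(2) by (metis pmf_eq_0_set_pmf set_map_pmf)
  then show ?thesis
    by (simp add: transition_prob_def sum_divide_distrib[symmetric] sum_pmf_pair_fst[OF assms(1)])
qed

text \<open>The marginal at \<open>y\<close> is the average of the transition probabilities into
  \<open>y\<close>, weighted by the first marginal, and an average does not exceed the
  maximum.\<close>

lemma marginal_snd_le_max_transition:
  assumes "finite (set_pmf P)"
  shows "pmf (map_pmf snd P) y \<le> max_transition P y"
proof -
  have "pmf (map_pmf snd P) y
      = (\<Sum>x\<in>fst ` set_pmf P. pmf (map_pmf fst P) x * transition_prob P x y)"
    by (simp only: sum_pmf_pair_snd[OF assms, symmetric] pmf_eq_transition[symmetric])
  also have "\<dots> \<le> (\<Sum>x\<in>fst ` set_pmf P. pmf (map_pmf fst P) x * max_transition P y)"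
    by (intro sum_mono mult_left_mono transition_prob_le_max assms) auto
  also have "\<dots> = max_transition P y"
    using assms by (simp add: sum_distrib_right[symmetric] sum_pmf_eq_1)
  finally show ?thesis .
qed

lemma leakage_sum_ge_1:
  assumes "finite (set_pmf P)"
  shows "1 \<le> leakage_sum P"
proof -
  have "1 = (\<Sum>y\<in>snd ` set_pmf P. pmf (map_pmf snd P) y)"
    using assms by (simp add: sum_pmf_eq_1)
  also have "\<dots> \<le> leakage_sum P"
    unfolding leakage_sum_def by (intro sum_mono marginal_snd_le_max_transition assms)
  finally show ?thesis .
qed

section \<open>Joint laws given by an input law and a channel\<close>

lemma pmf_channel_joint: "pmf (channel_joint p W) (x, y) = pmf p x * pmf (W x) y"
proof -
  have "pmf (channel_joint p W) (x, y)
      = measure_pmf.expectation p (\<lambda>x'. indicator {x} x' * pmf (W x) y)"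
    unfolding channel_joint_def pmf_bind
  proof (rule arg_cong[where f = "measure_pmf.expectation p"], rule ext)
    fix x'
    show "pmf (map_pmf (Pair x') (W x')) (x, y) = indicator {x} x' * pmf (W x) y"
    proof (cases "x' = x")
      case True
      then show ?thesis by (simp add: pmf_map_inj' inj_on_def)
    next
      case False
      then have "(x, y) \<notin> set_pmf (map_pmf (Pair x') (W x'))" by auto
      with False show ?thesis by (simp add: pmf_eq_0_set_pmf)
    qed
  qed
  then show ?thesis by (simp add: measure_pmf_single)
qed

lemma map_fst_channel_joint: "map_pmf fst (channel_joint p W) = p"
  by (simp add: channel_joint_def map_bind_pmf pmf.map_comp o_def map_pmf_const bind_return_pmf')

lemma set_channel_joint: "set_pmf (channel_joint p W) = (SIGMA x:set_pmf p. set_pmf (W x))"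
  by (auto simp: channel_joint_def)

section \<open>Maximal leakage of finitely supported laws\<close>

text \<open>Turns the guarded conditional statement into a product rule for all values: on a null
  conditioning event the left-hand side is at most the first factor, which is zero.\<close>

lemma markov_chain_mult:
  assumes "markov_chain R A B C"
  shows "\<P>(\<omega> in measure_pmf R. A \<omega> = a \<and> B \<omega> = b \<and> C \<omega> = c)
       = \<P>(\<omega> in measure_pmf R. A \<omega> = a \<and> B \<omega> = b) * \<P>(\<omega> in measure_pmf R. C \<omega> = c \<bar> B \<omega> = b)"
proof (cases "\<P>(\<omega> in measure_pmf R. A \<omega> = a \<and> B \<omega> = b) > 0")
  case True
  then have "\<P>(\<omega> in measure_pmf R. C \<omega> = c \<bar> A \<omega> = a \<and> B \<omega> = b) = \<P>(\<omega> in measure_pmf R. C \<omega> = c \<bar> B \<omega> = b)"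
    using assms unfolding markov_chain_def by blast
  with True show ?thesis
    by (simp add: cond_prob_def field_simps conj_ac)
next
  case False
  then have 0: "\<P>(\<omega> in measure_pmf R. A \<omega> = a \<and> B \<omega> = b) = 0"
    by (simp add: zero_less_measure_iff)
  have "\<P>(\<omega> in measure_pmf R. A \<omega> = a \<and> B \<omega> = b \<and> C \<omega> = c) \<le> \<P>(\<omega> in measure_pmf R. A \<omega> = a \<and> B \<omega> = b)"
    by (intro measure_pmf.finite_measure_mono) auto
  with 0 show ?thesis by (simp add: measure_le_0_iff)
qed

lemma leakage_candidate_le:
  fixes P :: "('a \<times> 'b) pmf"
  assumes fin: "finite (set_pmf P)" and cand: "(\<U>, Q) \<in> leakage_candidates P"
  shows "\<P>((u, x, y, v) in measure_pmf Q. u = v)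
       \<le> (MAX u\<in>\<U>. pmf (map_pmf fst Q) u) * leakage_sum P"
proof -
  let ?A = "fst ` set_pmf P" and ?B = "snd ` set_pmf P"
  define U X Y V where "U = (\<lambda>(u::nat, x::'a, y::'b, v::nat). u)" and "X = (\<lambda>(u::nat, x::'a, y::'b, v::nat). x)"
    and "Y = (\<lambda>(u::nat, x::'a, y::'b, v::nat). y)" and "V = (\<lambda>(u::nat, x::'a, y::'b, v::nat). v)"
  note UXYV = U_def X_def Y_def V_def
  let ?m = "MAX u\<in>\<U>. pmf (map_pmf fst Q) u"
  define g where "g y u = \<P>(\<omega> in measure_pmf Q. V \<omega> = u \<bar> Y \<omega> = y)" for y u
  have finU: "finite \<U>" and sub: "set_pmf Q \<subseteq> \<U> \<times> UNIV \<times> UNIV \<times> \<U>"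
    and marg: "map_pmf (\<lambda>(u, x, y, v). (x, y)) Q = P"
    and mc: "markov_chain4 Q U X Y V"
    using cand by (auto simp: leakage_candidates_def U_def X_def Y_def V_def)
  have mc1: "markov_chain Q U X Y" and mc2: "markov_chain Q (\<lambda>\<omega>. (U \<omega>, X \<omega>)) Y V"
    using mc by (auto simp: markov_chain4_def)
  have sub': "set_pmf Q \<subseteq> \<U> \<times> ?A \<times> ?B \<times> \<U>"
    using sub unfolding marg[symmetric] by (force simp: image_iff)
  have Pxy: "\<P>(\<omega> in measure_pmf Q. Y \<omega> = y \<and> X \<omega> = x) = pmf P (x, y)" for x y
    unfolding marg[symmetric] pmf_map by (intro arg_cong[where f = "measure _"]) (auto simp: UXYV)
  have Px: "\<P>(\<omega> in measure_pmf Q. X \<omega> = x) = pmf (map_pmf fst P) x" for x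
    unfolding marg[symmetric] pmf.map_comp pmf_map
    by (intro arg_cong[where f = "measure _"]) (auto simp: UXYV)
  have trans: "\<P>(\<omega> in measure_pmf Q. Y \<omega> = y \<bar> X \<omega> = x) = transition_prob P x y" for x y
    by (simp add: cond_prob_def transition_prob_def Pxy[simplified] Px[simplified])
  have g_nonneg: "0 \<le> g y u" for y u
    by (simp add: g_def cond_prob_def)
  \<comment> \<open>The two Markov properties factor an atom as
    \<open>P(u, x) P(y | x) P(v | y)\<close>, with \<open>g y v\<close> as the last factor. Only the
    middle factor is enlarged, which removes its dependence on \<open>x\<close>.\<close>
  have atom: "pmf Q (u, x, y, v) \<le> \<P>(\<omega> in measure_pmf Q. U \<omega> = u \<and> X \<omega> = x) * max_transition P y * g y v"
    if "x \<in> ?A" for u x y v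
  proof -
    have "pmf Q (u, x, y, v)
        = \<P>(\<omega> in measure_pmf Q. (U \<omega>, X \<omega>) = (u, x) \<and> Y \<omega> = y \<and> V \<omega> = v)"
      unfolding measure_pmf_single[symmetric] by (intro arg_cong[where f = "measure _"]) (auto simp: UXYV)
    also have "\<dots> = \<P>(\<omega> in measure_pmf Q. U \<omega> = u \<and> X \<omega> = x \<and> Y \<omega> = y) * g y v"
      using markov_chain_mult[OF mc2, of "(u, x)" y v] by (simp add: g_def)
    also have "\<dots> = \<P>(\<omega> in measure_pmf Q. U \<omega> = u \<and> X \<omega> = x) * transition_prob P x y * g y v"
      using markov_chain_mult[OF mc1, of u x y] by (simp add: trans)
    also have "\<dots> \<le> \<P>(\<omega> in measure_pmf Q. U \<omega> = u \<and> X \<omega> = x) * max_transition P y * g y v"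
      using that by (intro mult_right_mono mult_left_mono transition_prob_le_max fin g_nonneg) auto
    finally show ?thesis .
  qed
  have sumx: "(\<Sum>x\<in>?A. \<P>(\<omega> in measure_pmf Q. U \<omega> = u \<and> X \<omega> = x)) = pmf (map_pmf fst Q) u" for u
  proof -
    have "(\<Sum>x\<in>?A. \<P>(\<omega> in measure_pmf Q. U \<omega> = u \<and> X \<omega> = x))
        = measure (measure_pmf Q) (\<Union>x\<in>?A. {\<omega>. U \<omega> = u \<and> X \<omega> = x})"
      using fin by (subst measure_pmf.finite_measure_finite_Union) (auto simp: disjoint_family_on_def)
    also have "\<dots> = pmf (map_pmf fst Q) u"
      unfolding pmf_map using sub'
      by (intro measure_pmf.finite_measure_eq_AE) (force simp: AE_measure_pmf_iff UXYV)+
    finally show ?thesis .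
  qed
  \<comment> \<open>An inequality, because at a value \<open>y\<close> of probability zero the
    conditional probabilities default to 0 and the sum is 0 instead of 1.\<close>
  have sumg: "(\<Sum>u\<in>\<U>. g y u) \<le> 1" for y
  proof -
    have "(\<Sum>u\<in>\<U>. \<P>(\<omega> in measure_pmf Q. V \<omega> = u \<and> Y \<omega> = y))
        = measure (measure_pmf Q) (\<Union>u\<in>\<U>. {\<omega>. V \<omega> = u \<and> Y \<omega> = y})"
      using finU by (subst measure_pmf.finite_measure_finite_Union) (auto simp: disjoint_family_on_def)
    also have "\<dots> \<le> \<P>(\<omega> in measure_pmf Q. Y \<omega> = y)"
      by (intro measure_pmf.finite_measure_mono) auto
    finally show ?thesis
      by (simp add: g_def cond_prob_def sum_divide_distrib[symmetric] divide_le_eq_1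
          order_less_le measure_nonneg)
  qed
  \<comment> \<open>The event of a correct guess, cut down to the finite product that contains the
    support of \<open>Q\<close>, so that its probability is a finite sum of atoms.\<close>
  let ?D = "(\<lambda>(u, y, x). (u, x, y, u)) ` (\<U> \<times> ?B \<times> ?A)"
  have "\<P>((u, x, y, v) in measure_pmf Q. u = v) = measure (measure_pmf Q) ?D"
    using sub' by (intro measure_pmf.finite_measure_eq_AE) (force simp: AE_measure_pmf_iff UXYV)+
  also have "\<dots> = (\<Sum>u\<in>\<U>. \<Sum>y\<in>?B. \<Sum>x\<in>?A. pmf Q (u, x, y, u))"
    using fin finU
    by (subst measure_measure_pmf_finite)
       (auto simp: sum.reindex inj_on_def sum.cartesian_product case_prod_unfold)
  also have "\<dots> \<le> (\<Sum>u\<in>\<U>. \<Sum>y\<in>?B. \<Sum>x\<in>?A.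
      \<P>(\<omega> in measure_pmf Q. U \<omega> = u \<and> X \<omega> = x) * max_transition P y * g y u)"
    by (intro sum_mono atom)
  also have "\<dots> = (\<Sum>u\<in>\<U>. \<Sum>y\<in>?B. pmf (map_pmf fst Q) u * max_transition P y * g y u)"
    by (simp add: sum_distrib_right[symmetric] sumx[simplified])
  also have "\<dots> \<le> (\<Sum>u\<in>\<U>. \<Sum>y\<in>?B. ?m * max_transition P y * g y u)"
    using finU
    by (intro sum_mono mult_right_mono max_transition_nonneg fin g_nonneg Max_ge) auto
  also have "\<dots> = (\<Sum>y\<in>?B. ?m * max_transition P y * (\<Sum>u\<in>\<U>. g y u))"
    by (subst sum.swap) (simp add: sum_distrib_left)
  also have "\<dots> \<le> (\<Sum>y\<in>?B. ?m * max_transition P y * 1)"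
  proof (intro sum_mono mult_left_mono sumg mult_nonneg_nonneg max_transition_nonneg fin)
    \<comment> \<open>The alphabet contains the values of \<open>U\<close> on the support of
      \<open>Q\<close>, so it is nonempty and \<open>Max\<close> is a genuine maximum of nonnegative
      numbers.\<close>
    obtain u where "u \<in> \<U>" using sub set_pmf_not_empty[of Q] by auto
    then show "0 \<le> ?m" using finU by (meson Max_ge finite_imageI image_eqI order_trans pmf_nonneg)
  qed
  also have "\<dots> = ?m * leakage_sum P"
    by (simp add: leakage_sum_def sum_distrib_left)
  finally show ?thesis .
qed

text \<open>A way to produce candidates: \<open>U\<close> is drawn from \<open>X\<close> alone
  through the kernel \<open>K\<close>, and the guess is a function of \<open>Y\<close>. Given
  \<open>X\<close>, the value of \<open>Y\<close> is thus independent of \<open>U\<close>; given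
  \<open>Y\<close>, the guess is deterministic, so further conditioning cannot change it.\<close>

lemma guess_markov_chain4:
  fixes P :: "('x \<times> 'y) pmf" and K :: "'x \<Rightarrow> 'u pmf" and h :: "'y \<Rightarrow> 'v"
  defines "Q \<equiv> map_pmf (\<lambda>((x, y), u). (u, x, y, h y)) (channel_joint P (\<lambda>(x, y). K x))"
  shows "markov_chain4 Q (\<lambda>(u, x, y, v). u) (\<lambda>(u, x, y, v). x) (\<lambda>(u, x, y, v). y) (\<lambda>(u, x, y, v). v)"
proof -
  define U X Y V where "U = (\<lambda>(u::'u, x::'x, y::'y, v::'v). u)" and "X = (\<lambda>(u::'u, x::'x, y::'y, v::'v). x)"
    and "Y = (\<lambda>(u::'u, x::'x, y::'y, v::'v). y)" and "V = (\<lambda>(u::'u, x::'x, y::'y, v::'v). v)"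
  note UXYV = U_def X_def Y_def V_def
  have mXU: "map_pmf (\<lambda>\<omega>. (X \<omega>, U \<omega>)) Q = channel_joint (map_pmf fst P) K"
    by (simp add: Q_def UXYV channel_joint_def pmf.map_comp map_bind_pmf bind_map_pmf o_def
        case_prod_unfold)
  have "\<P>(\<omega> in measure_pmf Q. U \<omega> = u \<and> X \<omega> = x) = pmf (map_pmf (\<lambda>\<omega>. (X \<omega>, U \<omega>)) Q) (x, u)" for u x
    by (simp add: pmf_map vimage_def conj_commute)
  then have UX: "\<P>(\<omega> in measure_pmf Q. U \<omega> = u \<and> X \<omega> = x) = pmf (map_pmf fst P) x * pmf (K x) u" for u x
    by (simp only: mXU pmf_channel_joint)
  have mXYU: "map_pmf (\<lambda>\<omega>. ((X \<omega>, Y \<omega>), U \<omega>)) Q = channel_joint P (\<lambda>(x, y). K x)"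
    by (simp add: Q_def UXYV pmf.map_comp o_def case_prod_unfold)
  have "\<P>(\<omega> in measure_pmf Q. U \<omega> = u \<and> X \<omega> = x \<and> Y \<omega> = y)
      = pmf (map_pmf (\<lambda>\<omega>. ((X \<omega>, Y \<omega>), U \<omega>)) Q) ((x, y), u)" for u x y
    by (simp add: pmf_map vimage_def conj_ac)
  then have UXY: "\<P>(\<omega> in measure_pmf Q. U \<omega> = u \<and> X \<omega> = x \<and> Y \<omega> = y) = pmf P (x, y) * pmf (K x) u" for u x y
    by (simp only: mXYU pmf_channel_joint prod.case)
  have mXY: "map_pmf (\<lambda>\<omega>. (X \<omega>, Y \<omega>)) Q = P"
    using map_fst_channel_joint[of P "\<lambda>(x, y). K x"]
    by (simp add: Q_def UXYV pmf.map_comp o_def case_prod_unfold)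
  have XY: "\<P>(\<omega> in measure_pmf Q. Y \<omega> = y \<and> X \<omega> = x) = pmf P (x, y)" for x y
    unfolding mXY[symmetric] by (simp add: pmf_map vimage_def conj_commute)
  have X: "\<P>(\<omega> in measure_pmf Q. X \<omega> = x) = pmf (map_pmf fst P) x" for x
    unfolding mXY[symmetric] by (simp add: pmf.map_comp o_def pmf_map vimage_def)
  have "markov_chain Q U X Y"
    unfolding markov_chain_def
  proof (intro allI impI)
    fix u x y
    assume "\<P>(\<omega> in measure_pmf Q. U \<omega> = u \<and> X \<omega> = x) > 0"
    \<comment> \<open>This factor occurs in both the numerator and the denominator of the
      conditional probability and cancels.\<close>
    then have "pmf (K x) u \<noteq> 0" using UX[of u x] by auto
    then show "\<P>(\<omega> in measure_pmf Q. Y \<omega> = y \<bar> U \<omega> = u \<and> X \<omega> = x)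
        = \<P>(\<omega> in measure_pmf Q. Y \<omega> = y \<bar> X \<omega> = x)"
      using UXY[of u x y] UX[of u x] XY[of y x] X[of x] by (simp add: cond_prob_def conj_ac)
  qed
  moreover have "markov_chain Q (\<lambda>\<omega>. (U \<omega>, X \<omega>)) Y V"
    unfolding markov_chain_def
  proof (intro allI impI)
    fix a y v
    let ?E = "\<lambda>\<omega>. (U \<omega>, X \<omega>) = a \<and> Y \<omega> = y"
    assume pos: "\<P>(\<omega> in measure_pmf Q. ?E \<omega>) > 0"
    also have "\<P>(\<omega> in measure_pmf Q. ?E \<omega>) \<le> \<P>(\<omega> in measure_pmf Q. Y \<omega> = y)"
      by (intro measure_pmf.finite_measure_mono) auto
    finally have posY: "\<P>(\<omega> in measure_pmf Q. Y \<omega> = y) > 0" .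
    have V: "V \<omega> = h (Y \<omega>)" if "\<omega> \<in> set_pmf Q" for \<omega>
      using that by (auto simp: Q_def UXYV)
    \<comment> \<open>Stated for any event of positive probability that fixes \<open>Y = y\<close>,
      so that it serves both sides of the Markov condition.\<close>
    have det: "\<P>(\<omega> in measure_pmf Q. V \<omega> = v \<bar> F \<omega>) = (if h y = v then 1 else 0)"
      if "\<P>(\<omega> in measure_pmf Q. F \<omega>) > 0" "\<And>\<omega>. F \<omega> \<Longrightarrow> Y \<omega> = y" for F
    proof -
      have "\<P>(\<omega> in measure_pmf Q. V \<omega> = v \<and> F \<omega>) = \<P>(\<omega> in measure_pmf Q. h y = v \<and> F \<omega>)"
        using V that(2) by (intro measure_pmf.finite_measure_eq_AE) (auto simp: AE_measure_pmf_iff)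
      with that(1) show ?thesis by (simp add: cond_prob_def)
    qed
    show "\<P>(\<omega> in measure_pmf Q. V \<omega> = v \<bar> ?E \<omega>) = \<P>(\<omega> in measure_pmf Q. V \<omega> = v \<bar> Y \<omega> = y)"
      using det[OF pos] det[OF posY] by simp
  qed
  ultimately show ?thesis
    by (simp add: markov_chain4_def UXYV)
qed

text \<open>
  Given \<open>X = x\<close>, the secret \<open>U\<close> is the label \<open>g x\<close> with probability \<open>1 / (N P\<^sub>X(x))\<close>, and otherwise
  uniform on \<open>N\<close> further labels. Thus no label is likelier than \<open>1 / N\<close>, and guessing the label of an
  \<open>x\<close> maximising \<open>P(y | x)\<close> succeeds with probability \<open>\<Sum>\<^sub>y max\<^sub>x P(y | x) / N\<close>.
\<close>

lemma leakage_candidate_attaining: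
  fixes P :: "('x \<times> 'y) pmf"
  assumes fin: "finite (set_pmf P)"
  obtains \<U> Q where "(\<U>, Q) \<in> leakage_candidates P"
    "\<P>((u, x, y, v) in measure_pmf Q. u = v) / (MAX u\<in>\<U>. pmf (map_pmf fst Q) u) = leakage_sum P"
proof -
  let ?p = "map_pmf fst P"
  define A where "A = fst ` set_pmf P"
  have finA: "finite A" "A \<noteq> {}" using fin by (auto simp: A_def set_pmf_not_empty)
  have ppos: "pmf ?p x > 0" if "x \<in> A" for x
    using that unfolding A_def set_map_pmf[symmetric] by (rule pmf_positive)
  \<comment> \<open>Labels below \<open>k\<close> identify the points of the support; the block
    \<open>{k..<k+N}\<close> is kept for the uninformative labels.\<close>
  obtain g :: "'x \<Rightarrow> nat" and k where g: "inj_on g A" "g ` A = {..<k}"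
    using finite_imp_inj_to_nat_seg[OF finA(1)] by (auto simp: lessThan_def)
  \<comment> \<open>A maximum likelihood estimate of \<open>x\<close> from \<open>y\<close>.\<close>
  define s where "s y = (SOME x. x \<in> A \<and> transition_prob P x y = max_transition P y)" for y
  have s: "s y \<in> A" "transition_prob P (s y) y = max_transition P y" for y
    using someI_ex[of "\<lambda>x. x \<in> A \<and> transition_prob P x y = max_transition P y"]
      max_transition_attained[OF fin, of y] unfolding s_def A_def by metis+
  define m where "m = Min (pmf ?p ` A)"
  have m: "m > 0" "\<And>x. x \<in> A \<Longrightarrow> m \<le> pmf ?p x"
    using finA ppos by (auto simp: m_def)
  \<comment> \<open>\<open>N\<close> is so large that \<open>1 / N\<close> lies below every atom of
    the first marginal; this makes each \<open>t x\<close> below a probability.\<close>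
  obtain N :: nat where N0: "N > 0" and N: "1 / real N < m"
    using ex_inverse_of_nat_less[OF m(1)] by (auto simp: inverse_eq_divide)
  define t where "t x = 1 / (real N * pmf ?p x)" for x
  have t: "0 \<le> t x" "t x \<le> 1" if "x \<in> A" for x
  proof -
    have "1 < m * real N" using N N0 by (simp add: divide_less_eq)
    also have "\<dots> \<le> pmf ?p x * real N" using m(2)[OF that] by (intro mult_right_mono) auto
    finally show "t x \<le> 1" by (simp add: t_def divide_le_eq mult.commute)
  qed (simp add: t_def)
  define J where "J = pmf_of_set {k..<k+N}"
  have J_set: "set_pmf J = {k..<k+N}"
    using N0 by (simp add: J_def)
  have J_le: "pmf J u \<le> 1 / real N" for u
    using N0 by (simp add: J_def indicator_def)
  define K where "K x = mix_pmf (t x) (return_pmf (g x)) J" for x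
  have pmf_K: "pmf (K x) u = t x * indicator {g x} u + (1 - t x) * pmf J u" if "x \<in> A" for x u
    using t[OF that] by (simp add: K_def mix_pmf_def pmf_bind integral_bernoulli_pmf indicator_def)
  define Q where "Q = map_pmf (\<lambda>((x, y), u). (u, x, y, g (s y))) (channel_joint P (\<lambda>(x, y). K x))"
  define \<U> where "\<U> = {..<k+N}"
  have gk: "g x < k" if "x \<in> A" for x using g(2) that by auto
  have K_set: "set_pmf (K x) \<subseteq> \<U>" if "x \<in> A" for x
    using gk[OF that] by (auto simp: K_def mix_pmf_def J_set \<U>_def split: if_splits)
  have Q_sub: "set_pmf Q \<subseteq> \<U> \<times> UNIV \<times> UNIV \<times> \<U>"
  proof -
    have "x \<in> A" if "(x, y) \<in> set_pmf P" for x y using that by (force simp: A_def)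
    moreover have "g (s y) \<in> \<U>" for y using gk[OF s(1), of y] by (simp add: \<U>_def)
    ultimately show ?thesis using K_set by (fastforce simp: Q_def set_channel_joint)
  qed
  have Q_marg: "map_pmf (\<lambda>(u, x, y, v). (x, y)) Q = P"
    using map_fst_channel_joint[of P "\<lambda>(x, y). K x"]
    by (simp add: Q_def pmf.map_comp o_def case_prod_unfold)
  have cand: "(\<U>, Q) \<in> leakage_candidates P"
    using guess_markov_chain4[where P = P and K = K and h = "\<lambda>y. g (s y)"] Q_sub Q_marg
    by (simp add: leakage_candidates_def Q_def \<U>_def)
  have pmf_U: "pmf (map_pmf fst Q) u = (\<Sum>x\<in>A. pmf ?p x * pmf (K x) u)" for u
  proof -
    have "map_pmf fst Q = bind_pmf ?p K"
      by (simp add: Q_def channel_joint_def pmf.map_comp map_bind_pmf bind_map_pmf o_def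
          case_prod_unfold pmf.map_ident)
    then have "pmf (map_pmf fst Q) u = measure_pmf.expectation ?p (\<lambda>x. pmf (K x) u)"
      by (simp only: pmf_bind)
    also have "\<dots> = (\<Sum>x\<in>A. pmf (K x) u * pmf ?p x)"
      using finA(1) by (intro integral_measure_pmf_real) (auto simp: A_def)
    finally show ?thesis by (simp only: mult.commute)
  qed
  have pt: "pmf ?p x * t x = 1 / real N" if "x \<in> A" for x
    using ppos[OF that] by (simp add: t_def)
  have U_label: "pmf (map_pmf fst Q) (g x) = 1 / real N" if x: "x \<in> A" for x
  proof -
    have "pmf J (g x) = 0"
      using gk[OF x] by (simp add: pmf_eq_0_set_pmf J_set)
    \<comment> \<open>Only \<open>x' = x\<close> contributes: \<open>g\<close> is injective on
      \<open>A\<close>, and \<open>J\<close> puts no mass below \<open>k\<close>.\<close>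
    then have "pmf (map_pmf fst Q) (g x) = (\<Sum>x'\<in>A. if x' = x then 1 / real N else 0)"
      unfolding pmf_U using g(1) x pt
      by (intro sum.cong) (auto simp: pmf_K indicator_def inj_on_eq_iff)
    then show ?thesis using finA x by simp
  qed
  have U_le: "pmf (map_pmf fst Q) u \<le> 1 / real N" for u
  proof (cases "u < k")
    case True
    then obtain x where "x \<in> A" "u = g x" using g(2) by (metis imageE lessThan_iff)
    then show ?thesis using U_label by simp
  next
    \<comment> \<open>From \<open>k\<close> on only the uniform part \<open>J\<close> contributes,
      at most \<open>1 / N\<close> under each \<open>x\<close>, and averaging over \<open>x\<close>
      keeps this bound.\<close>
    case False
    have "pmf (map_pmf fst Q) u \<le> (\<Sum>x\<in>A. pmf ?p x * (1 / real N))"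
      unfolding pmf_U
    proof (intro sum_mono mult_left_mono pmf_nonneg)
      fix x assume x: "x \<in> A"
      then have "pmf (K x) u = (1 - t x) * pmf J u"
        using False gk[OF x] by (auto simp: pmf_K indicator_def)
      also have "\<dots> \<le> 1 * (1 / real N)"
        using t[OF x] by (intro mult_mono J_le) auto
      finally show "pmf (K x) u \<le> 1 / real N" by simp
    qed
    also have "\<dots> = 1 / real N"
      using finA by (simp add: sum_divide_distrib[symmetric] sum_pmf_eq_1 A_def)
    finally show ?thesis .
  qed
  have max: "(MAX u\<in>\<U>. pmf (map_pmf fst Q) u) = 1 / real N"
  proof (rule Max_eqI)
    obtain x where x: "x \<in> A" using finA by auto
    show "1 / real N \<in> pmf (map_pmf fst Q) ` \<U>"
      using U_label[OF x] gk[OF x] by (intro image_eqI[of _ _ "g x"]) (auto simp: \<U>_def)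
  qed (use U_le in \<open>auto simp: \<U>_def\<close>)
  have "\<P>((u, x, y, v) in measure_pmf Q. u = v) = leakage_sum P / real N"
  proof -
    let ?B = "snd ` set_pmf P"
    let ?D = "(\<lambda>y. ((s y, y), g (s y))) ` ?B"
    have "\<P>((u, x, y, v) in measure_pmf Q. u = v)
        = measure (measure_pmf (channel_joint P (\<lambda>(x, y). K x))) {((x, y), u). u = g (s y)}"
      unfolding Q_def measure_map_pmf by (intro arg_cong[where f = "measure _"]) auto
    also have "\<dots> = measure (measure_pmf (channel_joint P (\<lambda>(x, y). K x))) ?D"
    proof (rule measure_pmf.finite_measure_eq_AE)
      \<comment> \<open>A correct guess is a label below \<open>k\<close>, so it comes from the
        branch \<open>g x\<close>, and injectivity gives \<open>x = s y\<close>. The event thus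
        consists of one atom for each \<open>y\<close>.\<close>
      have D: "((x, y), g (s y)) \<in> ?D" if "(x, y) \<in> set_pmf P" "g (s y) \<in> set_pmf (K x)" for x y
      proof -
        have x: "x \<in> A" using that(1) by (force simp: A_def)
        have "g (s y) \<notin> {k..<k+N}" using gk[OF s(1)[of y]] by simp
        then have "g (s y) = g x"
          using that(2) by (auto simp: K_def mix_pmf_def J_set split: if_splits)
        then have "x = s y" using g(1) x s(1) by (metis inj_onD)
        moreover have "y \<in> ?B" using that(1) by force
        ultimately show ?thesis by (intro image_eqI[of _ _ y]) auto
      qed
      then show "AE z in measure_pmf (channel_joint P (\<lambda>(x, y). K x)).
          (z \<in> {((x, y), u). u = g (s y)}) = (z \<in> ?D)"
        by (auto simp: AE_measure_pmf_iff set_channel_joint)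
    qed auto
    also have "\<dots> = (\<Sum>y\<in>?B. pmf P (s y, y) * pmf (K (s y)) (g (s y)))"
      using fin by (subst measure_measure_pmf_finite)
        (auto simp: sum.reindex inj_on_def pmf_channel_joint)
    \<comment> \<open>The joint mass is \<open>P(s y)\<close> times the maximal transition
      probability, and \<open>P(s y) * t (s y)\<close> is \<open>1 / N\<close> by the choice of
      \<open>t\<close>.\<close>
    also have "\<dots> = (\<Sum>y\<in>?B. max_transition P y / real N)"
    proof (rule sum.cong)
      fix y
      have "pmf J (g (s y)) = 0"
        using gk[OF s(1)[of y]] by (simp add: pmf_eq_0_set_pmf J_set)
      then have "pmf P (s y, y) * pmf (K (s y)) (g (s y))
          = pmf ?p (s y) * t (s y) * max_transition P y"
        by (simp add: pmf_K s pmf_eq_transition)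
      then show "pmf P (s y, y) * pmf (K (s y)) (g (s y)) = max_transition P y / real N"
        by (simp add: pt s)
    qed simp
    also have "\<dots> = leakage_sum P / real N"
      by (simp add: leakage_sum_def sum_divide_distrib)
    finally show ?thesis .
  qed
  with max N0 cand show ?thesis by (intro that) auto
qed

text \<open>Ensures that the quotient in \<open>maximal_leakage\<close> is a genuine one: any point
  in the support of \<open>Q\<close> gives a value of \<open>U\<close> with positive mass.\<close>

lemma leakage_candidate_max_pos:
  assumes "(\<U>, Q) \<in> leakage_candidates P"
  shows "0 < (MAX u\<in>\<U>. pmf (map_pmf fst Q) u)"
proof -
  have finU: "finite \<U>" and sub: "set_pmf Q \<subseteq> \<U> \<times> UNIV \<times> UNIV \<times> \<U>"
    using assms by (auto simp: leakage_candidates_def)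
  obtain \<omega> where \<omega>: "\<omega> \<in> set_pmf Q" using set_pmf_not_empty[of Q] by auto
  then have "fst \<omega> \<in> \<U>" and pos: "0 < pmf (map_pmf fst Q) (fst \<omega>)"
    using sub by (auto intro!: pmf_positive)
  then have "pmf (map_pmf fst Q) (fst \<omega>) \<le> (MAX u\<in>\<U>. pmf (map_pmf fst Q) u)"
    using finU by (intro Max_ge) auto
  with pos show ?thesis by linarith
qed

text \<open>The closed form on which all properties rest. Monotonicity of \<open>ereal_ln\<close>
  carries the bound over to every candidate, and one candidate attains it. As the sum is at least 1,
  the value is finite and \<open>ln\<close> agrees with \<open>ereal_ln\<close>.\<close>

theorem maximal_leakage_eq:
  fixes R :: "'w pmf"
  assumes fin: "finite (set_pmf (map_pmf (\<lambda>\<omega>. (X \<omega>, Y \<omega>)) R))"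
  shows "maximal_leakage R X Y = ereal (ln (leakage_sum (map_pmf (\<lambda>\<omega>. (X \<omega>, Y \<omega>)) R)))"
proof -
  let ?P = "map_pmf (\<lambda>\<omega>. (X \<omega>, Y \<omega>)) R"
  let ?f = "\<lambda>(\<U>, Q). ereal_ln (\<P>((u, x, y, v) in measure_pmf Q. u = v) / (MAX u\<in>\<U>. pmf (map_pmf fst Q) u))"
  have pos: "leakage_sum ?P > 0" using leakage_sum_ge_1[OF fin] by linarith
  have ln: "ereal (ln (leakage_sum ?P)) = ereal_ln (leakage_sum ?P)"
    using pos by (simp add: ereal_ln_def)
  have mono: "ereal_ln a \<le> ereal_ln b" if "a \<le> b" for a b
    using that by (auto simp: ereal_ln_def)
  obtain \<U> Q where UQ: "(\<U>, Q) \<in> leakage_candidates ?P"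
    "\<P>((u, x, y, v) in measure_pmf Q. u = v) / (MAX u\<in>\<U>. pmf (map_pmf fst Q) u) = leakage_sum ?P"
    by (rule leakage_candidate_attaining[OF fin])
  have "(SUP z\<in>leakage_candidates ?P. ?f z) = ereal_ln (leakage_sum ?P)"
  proof (rule antisym)
    show "(SUP z\<in>leakage_candidates ?P. ?f z) \<le> ereal_ln (leakage_sum ?P)"
    proof (rule SUP_least)
      fix z assume "z \<in> leakage_candidates ?P"
      then obtain \<U> Q where z: "z = (\<U>, Q)" "(\<U>, Q) \<in> leakage_candidates ?P" by (cases z) auto
      show "?f z \<le> ereal_ln (leakage_sum ?P)"
        unfolding z(1) prod.case
        using leakage_candidate_le[OF fin z(2)] leakage_candidate_max_pos[OF z(2)]
        by (intro mono) (simp add: divide_le_eq mult.commute)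
    qed
    have "ereal_ln (leakage_sum ?P) = ?f (\<U>, Q)"
      by (simp only: prod.case UQ(2))
    also have "\<dots> \<le> (SUP z\<in>leakage_candidates ?P. ?f z)"
      by (rule SUP_upper[where f = ?f, OF UQ(1)])
    finally show "ereal_ln (leakage_sum ?P) \<le> (SUP z\<in>leakage_candidates ?P. ?f z)" .
  qed
  then show ?thesis by (simp only: maximal_leakage_def ln)
qed

section \<open>Equality cases: independence and determinism\<close>

lemma leakage_sum_eq_1_iff:
  assumes fin: "finite (set_pmf P)"
  shows "leakage_sum P = 1 \<longleftrightarrow> P = pair_pmf (map_pmf fst P) (map_pmf snd P)"
proof
  let ?A = "fst ` set_pmf P" and ?B = "snd ` set_pmf P"
  assume "leakage_sum P = 1"
  \<comment> \<open>The maxima dominate the marginal of \<open>Y\<close>, which also sums to 1;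
    nonnegative differences with sum zero all vanish.\<close>
  then have "(\<Sum>y\<in>?B. max_transition P y - pmf (map_pmf snd P) y) = 0"
    using fin by (simp add: sum_subtractf leakage_sum_def sum_pmf_eq_1)
  then have max: "max_transition P y = pmf (map_pmf snd P) y" if "y \<in> ?B" for y
    using that fin marginal_snd_le_max_transition[OF fin] by (subst (asm) sum_nonneg_eq_0_iff) auto
  \<comment> \<open>The same argument a second time: the row of \<open>x\<close> is dominated
    termwise by the marginal of \<open>Y\<close>, and both sum to 1.\<close>
  have trans: "transition_prob P x y = pmf (map_pmf snd P) y" if x: "x \<in> ?A" and y: "y \<in> ?B" for x y
  proof -
    have le: "transition_prob P x y' \<le> pmf (map_pmf snd P) y'" if "y' \<in> ?B" for y'
      using transition_prob_le_max[OF fin x] max[OF that] by metis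
    have "(\<Sum>y\<in>?B. pmf (map_pmf snd P) y - transition_prob P x y) = 0"
      using fin sum_transition_prob[OF fin x] by (simp add: sum_subtractf sum_pmf_eq_1)
    then show ?thesis
      using y fin le by (subst (asm) sum_nonneg_eq_0_iff) auto
  qed
  show "P = pair_pmf (map_pmf fst P) (map_pmf snd P)"
  proof (rule pmf_eqI, clarify)
    fix x y
    show "pmf P (x, y) = pmf (pair_pmf (map_pmf fst P) (map_pmf snd P)) (x, y)"
    proof (cases "x \<in> ?A \<and> y \<in> ?B")
      case True
      then show ?thesis by (simp add: pmf_pair pmf_eq_transition[of P] trans)
    next
      case False
      then have "(x, y) \<notin> set_pmf P" by force
      then have "pmf P (x, y) = 0" by (simp add: pmf_eq_0_set_pmf)
      moreover have "pmf (map_pmf fst P) x = 0 \<or> pmf (map_pmf snd P) y = 0"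
        using False by (simp add: pmf_eq_0_set_pmf)
      ultimately show ?thesis by (auto simp: pmf_pair)
    qed
  qed
next
  let ?B = "snd ` set_pmf P"
  assume P: "P = pair_pmf (map_pmf fst P) (map_pmf snd P)"
  \<comment> \<open>Under a product law every transition probability from the support equals the
    marginal of \<open>Y\<close>, hence so does the maximum.\<close>
  have "max_transition P y = pmf (map_pmf snd P) y" for y
  proof -
    obtain x where x: "x \<in> fst ` set_pmf P" "transition_prob P x y = max_transition P y"
      by (rule max_transition_attained[OF fin])
    have "pmf (map_pmf fst P) x \<noteq> 0" using x(1) by (simp add: pmf_eq_0_set_pmf)
    moreover have "pmf P (x, y) = pmf (map_pmf fst P) x * pmf (map_pmf snd P) y"
      by (subst P) (rule pmf_pair)
    ultimately show ?thesis by (simp add: transition_prob_def flip: x(2))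
  qed
  then show "leakage_sum P = 1"
    using fin by (simp add: leakage_sum_def sum_pmf_eq_1)
qed

text \<open>Each row of transition probabilities sums to 1, so the cardinality is the sum of all
  entries. Equality holds exactly when every column sum equals the column maximum, that is, when
  each column has only one nonzero entry; its position is the value of \<open>f\<close>.\<close>

lemma leakage_sum_eq_card_iff:
  assumes fin: "finite (set_pmf P)"
  shows "leakage_sum P = real (card (fst ` set_pmf P)) \<longleftrightarrow> (\<exists>f. \<forall>\<omega>\<in>set_pmf P. fst \<omega> = f (snd \<omega>))"
proof -
  let ?A = "fst ` set_pmf P" and ?B = "snd ` set_pmf P"
  have "(\<Sum>y\<in>?B. \<Sum>x\<in>?A. transition_prob P x y) = (\<Sum>x\<in>?A. \<Sum>y\<in>?B. transition_prob P x y)"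
    by (rule sum.swap)
  also have "\<dots> = real (card ?A)"
    using sum_transition_prob[OF fin] by simp
  finally have card: "(\<Sum>y\<in>?B. \<Sum>x\<in>?A. transition_prob P x y) = real (card ?A)" .
  have le: "max_transition P y \<le> (\<Sum>x\<in>?A. transition_prob P x y)" for y
  proof -
    obtain x where "x \<in> ?A" "transition_prob P x y = max_transition P y"
      by (rule max_transition_attained[OF fin])
    then show ?thesis
      using fin member_le_sum[of x ?A "\<lambda>x. transition_prob P x y"]
      by (simp add: transition_prob_nonneg)
  qed
  show ?thesis
  proof
    assume "leakage_sum P = real (card ?A)"
    then have "(\<Sum>y\<in>?B. (\<Sum>x\<in>?A. transition_prob P x y) - max_transition P y) = 0"
      by (simp add: sum_subtractf leakage_sum_def card)
    then have eq: "max_transition P y = (\<Sum>x\<in>?A. transition_prob P x y)" if "y \<in> ?B" for y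
      using that fin le by (subst (asm) sum_nonneg_eq_0_iff) auto
    have "\<forall>y. \<exists>x. x \<in> ?A \<and> transition_prob P x y = max_transition P y"
      using max_transition_attained[OF fin] by blast
    then obtain s where s: "\<And>y. s y \<in> ?A" "\<And>y. transition_prob P (s y) y = max_transition P y"
      by metis
    have "x = s y" if xy: "(x, y) \<in> set_pmf P" for x y
    proof (rule ccontr)
      assume neq: "x \<noteq> s y"
      have x: "x \<in> ?A" and y: "y \<in> ?B" using xy by force+
      have "(\<Sum>x\<in>?A. transition_prob P x y)
          = transition_prob P (s y) y + (\<Sum>x\<in>?A - {s y}. transition_prob P x y)"
        using fin s(1) by (intro sum.remove) auto
      then have "(\<Sum>x\<in>?A - {s y}. transition_prob P x y) = 0"
        using eq[OF y] s(2)[of y] by simp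
      then have "transition_prob P x y = 0"
        using fin x neq by (subst (asm) sum_nonneg_eq_0_iff) (auto simp: transition_prob_nonneg)
      then have "pmf P (x, y) = 0" by (simp add: pmf_eq_transition)
      with xy show False by (simp add: pmf_eq_0_set_pmf)
    qed
    then show "\<exists>f. \<forall>\<omega>\<in>set_pmf P. fst \<omega> = f (snd \<omega>)" by (intro exI[of _ s]) auto
  next
    assume "\<exists>f. \<forall>\<omega>\<in>set_pmf P. fst \<omega> = f (snd \<omega>)"
    then obtain f where f: "\<And>x y. (x, y) \<in> set_pmf P \<Longrightarrow> x = f y" by force
    have "(\<Sum>x\<in>?A. transition_prob P x y) = max_transition P y" for y
    proof (rule antisym[OF _ le])
      have 0: "transition_prob P x y = 0" if "x \<noteq> f y" for x
        using that f[of x y] by (auto simp: transition_prob_def pmf_eq_0_set_pmf)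
      have "(\<Sum>x\<in>?A. transition_prob P x y)
          = (\<Sum>x\<in>?A. if x = f y then transition_prob P (f y) y else 0)"
        by (intro sum.cong) (auto simp: 0)
      \<comment> \<open>If \<open>f y\<close> lies outside the support the sum is 0, and
        nonnegativity of the maximum gives the bound.\<close>
      also have "\<dots> \<le> max_transition P y"
        using fin by (auto simp: max_transition_nonneg transition_prob_le_max)
      finally show "(\<Sum>x\<in>?A. transition_prob P x y) \<le> max_transition P y" .
    qed
    then show "leakage_sum P = real (card ?A)"
      by (simp add: leakage_sum_def flip: card)
  qed
qed

section \<open>Additivity\<close>

lemma prob_indep_vars_eq:
  fixes R :: "'w pmf"
  assumes "prob_space.indep_vars (measure_pmf R) (\<lambda>_. count_space UNIV) Z I" "finite I"
  shows "measure (measure_pmf R) {\<omega>. \<forall>i\<in>I. Z i \<omega> = z i} = (\<Prod>i\<in>I. pmf (map_pmf (Z i) R) (z i))"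
proof (cases "I = {}")
  case False
  have "measure (measure_pmf R) (\<Inter>i\<in>I. Z i -` {z i} \<inter> space (measure_pmf R))
      = (\<Prod>i\<in>I. measure (measure_pmf R) (Z i -` {z i} \<inter> space (measure_pmf R)))"
    using assms False by (intro prob_space.indep_varsD_finite[OF prob_space_measure_pmf]) auto
  moreover have "(\<Inter>i\<in>I. Z i -` {z i} \<inter> space (measure_pmf R)) = {\<omega>. \<forall>i\<in>I. Z i \<omega> = z i}"
    using False by auto
  ultimately show ?thesis by (simp add: pmf_map)
qed simp

text \<open>Independence makes the transition probabilities products over the coordinates. A maximum
  of products of nonnegative factors over a product set is the product of the maxima, and the sum of
  such products factors likewise. Restriction to \<open>I\<close> makes the tuples elements of
  \<open>PiE\<close>.\<close>

lemma leakage_sum_indep: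
  fixes R :: "'w pmf" and X :: "'i \<Rightarrow> 'w \<Rightarrow> 'a" and Y :: "'i \<Rightarrow> 'w \<Rightarrow> 'b"
  defines "P \<equiv> \<lambda>i. map_pmf (\<lambda>\<omega>. (X i \<omega>, Y i \<omega>)) R"
    and "J \<equiv> \<lambda>I. map_pmf (\<lambda>\<omega>. (restrict (\<lambda>i. X i \<omega>) I, restrict (\<lambda>i. Y i \<omega>) I)) R"
  assumes finI: "finite I" and fin: "\<And>i. i \<in> I \<Longrightarrow> finite (set_pmf (P i))"
    and ind: "prob_space.indep_vars (measure_pmf R) (\<lambda>_. count_space UNIV) (\<lambda>i \<omega>. (X i \<omega>, Y i \<omega>)) I"
  shows "finite (set_pmf (J I))" "leakage_sum (J I) = (\<Prod>i\<in>I. leakage_sum (P i))"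
proof -
  let ?A = "\<lambda>i. fst ` set_pmf (P i)" and ?B = "\<lambda>i. snd ` set_pmf (P i)"
  have sub: "set_pmf (J I) \<subseteq> PiE I ?A \<times> PiE I ?B"
    by (force simp: J_def P_def PiE_def)
  have finB: "finite (PiE I ?B)" and finA: "finite (PiE I ?A)"
    using finI fin by (auto intro: finite_PiE)
  show finJ: "finite (set_pmf (J I))"
    using finite_subset[OF sub] finA finB by auto
  have pmf_J: "pmf (J I) (x, y) = (\<Prod>i\<in>I. pmf (P i) (x i, y i))"
    if "x \<in> extensional I" "y \<in> extensional I" for x y
  proof -
    have "pmf (J I) (x, y) = measure (measure_pmf R) {\<omega>. \<forall>i\<in>I. (X i \<omega>, Y i \<omega>) = (x i, y i)}"
      unfolding J_def pmf_map using that
      by (intro arg_cong[where f = "measure _"])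
        (auto simp: fun_eq_iff restrict_def extensional_def)
    then show ?thesis
      using prob_indep_vars_eq[OF ind finI, of "\<lambda>i. (x i, y i)"] by (simp add: P_def)
  qed
  have indX: "prob_space.indep_vars (measure_pmf R) (\<lambda>_. count_space UNIV) X I"
    using prob_space.indep_vars_compose2[OF prob_space_measure_pmf ind, of "\<lambda>_. fst" "\<lambda>_. count_space UNIV"] by simp
  have pmf_fst: "pmf (map_pmf fst (J I)) x = (\<Prod>i\<in>I. pmf (map_pmf fst (P i)) (x i))"
    if "x \<in> extensional I" for x
  proof -
    have "pmf (map_pmf fst (J I)) x = measure (measure_pmf R) {\<omega>. \<forall>i\<in>I. X i \<omega> = x i}"
      unfolding J_def pmf.map_comp pmf_map using that
      by (intro arg_cong[where f = "measure _"])
        (auto simp: fun_eq_iff restrict_def extensional_def)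
    then show ?thesis
      using prob_indep_vars_eq[OF indX finI, of x] by (simp add: P_def pmf.map_comp o_def)
  qed
  have trans: "transition_prob (J I) x y = (\<Prod>i\<in>I. transition_prob (P i) (x i) (y i))"
    if "x \<in> extensional I" "y \<in> extensional I" for x y
    by (simp add: transition_prob_def pmf_J[OF that] pmf_fst[OF that(1)] prod_dividef)
  \<comment> \<open>The maximum ranges over the exact support, so equality is required; independence
    supplies it, as a product of positive masses is positive.\<close>
  have supp: "fst ` set_pmf (J I) = PiE I ?A"
  proof
    show "fst ` set_pmf (J I) \<subseteq> PiE I ?A" using sub by force
    show "PiE I ?A \<subseteq> fst ` set_pmf (J I)"
    proof
      fix x assume x: "x \<in> PiE I ?A"
      then have "pmf (map_pmf fst (P i)) (x i) \<noteq> 0" if "i \<in> I" for i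
        using that by (auto simp: pmf_eq_0_set_pmf PiE_iff)
      then have "pmf (map_pmf fst (J I)) x \<noteq> 0"
        using x finI by (simp add: pmf_fst PiE_iff)
      then show "x \<in> fst ` set_pmf (J I)" by (simp add: pmf_eq_0_set_pmf)
    qed
  qed
  have max: "max_transition (J I) y = (\<Prod>i\<in>I. max_transition (P i) (y i))"
    if y: "y \<in> extensional I" for y
    unfolding max_transition_def[of "J I"] supp
  proof (rule Max_eqI)
    fix z assume "z \<in> (\<lambda>x. transition_prob (J I) x y) ` PiE I ?A"
    then obtain x where "x \<in> PiE I ?A" "z = transition_prob (J I) x y" by auto
    then show "z \<le> (\<Prod>i\<in>I. max_transition (P i) (y i))"
      using y fin by (auto simp: trans PiE_iff transition_prob_nonneg
          intro!: prod_mono transition_prob_le_max)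
  next
    \<comment> \<open>Maximisers chosen in each coordinate combine to a maximising tuple.\<close>
    have "\<exists>x. x \<in> ?A i \<and> transition_prob (P i) x (y i) = max_transition (P i) (y i)" if "i \<in> I" for i
      using max_transition_attained[OF fin[OF that]] by metis
    then obtain s where s: "\<And>i. i \<in> I \<Longrightarrow> s i \<in> ?A i"
      "\<And>i. i \<in> I \<Longrightarrow> transition_prob (P i) (s i) (y i) = max_transition (P i) (y i)"
      by metis
    show "(\<Prod>i\<in>I. max_transition (P i) (y i)) \<in> (\<lambda>x. transition_prob (J I) x y) ` PiE I ?A"
      using s y by (intro image_eqI[of _ _ "restrict s I"]) (auto simp: trans)
  qed (use finA in simp)
  \<comment> \<open>For the outputs an inclusion of the support in the product set suffices, since
    extra terms are zero.\<close>
  have "leakage_sum (J I) = (\<Sum>y\<in>PiE I ?B. max_transition (J I) y)"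
    using sub by (intro leakage_sum_superset finJ finB) force
  also have "\<dots> = (\<Sum>y\<in>PiE I ?B. \<Prod>i\<in>I. max_transition (P i) (y i))"
    by (intro sum.cong) (auto simp: max PiE_def)
  also have "\<dots> = (\<Prod>i\<in>I. leakage_sum (P i))"
    using finI fin by (simp add: leakage_sum_def prod_sum_PiE)
  finally show "leakage_sum (J I) = (\<Prod>i\<in>I. leakage_sum (P i))" .
qed

section \<open>Channels\<close>

lemma transition_prob_channel_joint:
  assumes "x \<in> set_pmf p"
  shows "transition_prob (channel_joint p W) x y = pmf (W x) y"
  using assms
  by (simp add: transition_prob_def pmf_channel_joint map_fst_channel_joint set_pmf_iff)

text \<open>With \<open>B\<close> fixed, the input law enters only through its support and the
  channel only through pointwise maxima, the form needed for convexity and concavity.\<close>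

lemma leakage_sum_channel_joint:
  assumes "finite (set_pmf p)" "finite B" "\<And>x. x \<in> set_pmf p \<Longrightarrow> set_pmf (W x) \<subseteq> B"
  shows "leakage_sum (channel_joint p W) = (\<Sum>y\<in>B. MAX x\<in>set_pmf p. pmf (W x) y)"
proof -
  have "set_pmf (channel_joint p W) \<subseteq> set_pmf p \<times> B"
    using assms(3) by (auto simp: set_channel_joint)
  moreover from this have "finite (set_pmf (channel_joint p W))"
    using assms(1,2) by (auto intro: finite_subset)
  moreover have "fst ` set_pmf (channel_joint p W) = set_pmf p"
    by (simp add: map_fst_channel_joint flip: set_map_pmf)
  ultimately show ?thesis
    using assms(2) by (subst leakage_sum_superset[of _ B])
      (auto simp: max_transition_def transition_prob_channel_joint image_def intro!: sum.cong)
qed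

lemma maximal_leakage_pair:
  assumes "finite (set_pmf P)"
  shows "maximal_leakage P fst snd = ereal (ln (leakage_sum P))"
  using maximal_leakage_eq[of fst snd P] assms by (simp add: pmf.map_ident)

lemma maximal_leakage_channel_joint:
  assumes "finite (set_pmf p)" "finite B" "\<And>x. x \<in> set_pmf p \<Longrightarrow> set_pmf (W x) \<subseteq> B"
  shows "maximal_leakage (channel_joint p W) fst snd = ereal (ln (\<Sum>y\<in>B. MAX x\<in>set_pmf p. pmf (W x) y))"
    and "1 \<le> (\<Sum>y\<in>B. MAX x\<in>set_pmf p. pmf (W x) y)"
proof -
  have "set_pmf (channel_joint p W) \<subseteq> set_pmf p \<times> B"
    using assms(3) by (auto simp: set_channel_joint)
  then have fin: "finite (set_pmf (channel_joint p W))"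
    using assms(1,2) by (auto intro: finite_subset)
  show "maximal_leakage (channel_joint p W) fst snd = ereal (ln (\<Sum>y\<in>B. MAX x\<in>set_pmf p. pmf (W x) y))"
    using maximal_leakage_pair[OF fin] leakage_sum_channel_joint[of p B W, OF assms] by simp
  show "1 \<le> (\<Sum>y\<in>B. MAX x\<in>set_pmf p. pmf (W x) y)"
    using leakage_sum_ge_1[OF fin] leakage_sum_channel_joint[of p B W, OF assms] by simp
qed

lemma pmf_mix_pmf:
  assumes "0 \<le> t" "t \<le> 1"
  shows "pmf (mix_pmf t p q) x = t * pmf p x + (1 - t) * pmf q x"
  using assms by (simp add: mix_pmf_def pmf_bind integral_bernoulli_pmf)

lemma ereal_exp_ln: "0 < r \<Longrightarrow> ereal_exp (ereal (ln r)) = ereal r"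
  by (simp add: ereal_exp_def)

text \<open>The witness is uniform on four points: \<open>X = 0\<close> forces \<open>Y = 0\<close>,
  while \<open>X = 1\<close> leaves \<open>Y\<close> uniform on three values. The column maxima are
  1, 1/3, 1/3 with sum 5/3; in the reverse direction they are 1/2 and 1 with sum 3/2.\<close>

lemma maximal_leakage_asymmetric:
  "\<exists>Q :: (nat \<times> nat) pmf. finite (set_pmf Q) \<and> maximal_leakage Q fst snd \<noteq> maximal_leakage Q snd fst"
proof -
  let ?S = "{(0, 0), (1, 0), (1, 1), (1, 2)} :: (nat \<times> nat) set"
  let ?T = "{(0, 0), (0, 1), (1, 1), (2, 1)} :: (nat \<times> nat) set"
  let ?Q = "pmf_of_set ?S" and ?Q' = "pmf_of_set ?T"
  have swap: "map_pmf (\<lambda>\<omega>. (snd \<omega>, fst \<omega>)) ?Q = ?Q'"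
    by (subst map_pmf_of_set_inj) (auto simp: inj_on_def)
  have fin: "finite (set_pmf ?Q)" "finite (set_pmf ?Q')" by simp_all
  have q: "pmf (map_pmf fst ?Q) 0 = 1 / 4" "pmf (map_pmf fst ?Q) 1 = 3 / 4"
    using sum_pmf_pair_fst[OF fin(1), of 0] sum_pmf_pair_fst[OF fin(1), of 1] by simp_all
  have l: "leakage_sum ?Q = 5 / 3"
    by (simp add: leakage_sum_def max_transition_def transition_prob_def q q[unfolded One_nat_def])
  have q': "pmf (map_pmf fst ?Q') 0 = 1 / 2" "pmf (map_pmf fst ?Q') 1 = 1 / 4"
    "pmf (map_pmf fst ?Q') 2 = 1 / 4"
    using sum_pmf_pair_fst[OF fin(2), of 0] sum_pmf_pair_fst[OF fin(2), of 1]
      sum_pmf_pair_fst[OF fin(2), of 2] by simp_all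
  have "leakage_sum ?Q' = 3 / 2"
    by (simp add: leakage_sum_def max_transition_def transition_prob_def q' q'[unfolded One_nat_def])
  moreover have "maximal_leakage ?Q snd fst = ereal (ln (leakage_sum ?Q'))"
    using maximal_leakage_eq[of snd fst ?Q] fin(2) unfolding swap by simp
  ultimately show ?thesis
    using maximal_leakage_pair[OF fin(1)] fin(1) l by (intro exI[of _ ?Q]) auto
qed

section \<open>The properties of maximal leakage, read off from the closed form\<close>

theorem corollary1:
  fixes P :: "('x \<times> 'y) pmf" and \<X> :: "'x set" and \<Y> :: "'y set"
  assumes "finite \<X>" and "finite \<Y>" and "set_pmf P \<subseteq> \<X> \<times> \<Y>"
  shows
    "(maximal_leakage P fst snd = 0 \<longleftrightarrow>
        P = pair_pmf (map_pmf fst P) (map_pmf snd P))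
   \<and> (\<forall>(n::nat) (R::'w pmf) (X::nat \<Rightarrow> 'w \<Rightarrow> 'a) (Y::nat \<Rightarrow> 'w \<Rightarrow> 'b)
         (A::nat \<Rightarrow> 'a set) (B::nat \<Rightarrow> 'b set).
        (\<forall>i\<in>{1..n}. finite (A i) \<and> finite (B i) \<and>
           (\<forall>\<omega>\<in>set_pmf R. X i \<omega> \<in> A i \<and> Y i \<omega> \<in> B i)) \<and>
        prob_space.indep_vars (measure_pmf R) (\<lambda>_. count_space UNIV)
          (\<lambda>i \<omega>. (X i \<omega>, Y i \<omega>)) {1..n} \<longrightarrow>
        maximal_leakage R (\<lambda>\<omega>. \<lambda>i\<in>{1..n}. X i \<omega>) (\<lambda>\<omega>. \<lambda>i\<in>{1..n}. Y i \<omega>)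
          = (\<Sum>i=1..n. maximal_leakage R (X i) (Y i)))
   \<and> (set_pmf (map_pmf fst P) = \<X> \<longrightarrow>
        (maximal_leakage P fst snd = ereal (ln (real (card \<X>))) \<longleftrightarrow>
         (\<exists>f. AE \<omega> in measure_pmf P. fst \<omega> = f (snd \<omega>))))
   \<and> (maximal_leakage P fst fst = ereal (renyi_entropy_0 P fst) \<and>
      renyi_entropy_0 P fst = ln (real (card (set_pmf (map_pmf fst P)))))
   \<and> (\<exists>Q :: (nat \<times> nat) pmf. finite (set_pmf Q) \<and>
        maximal_leakage Q fst snd \<noteq> maximal_leakage Q snd fst)
   \<and> (\<forall>(S::'x set) (p::'x pmf) p\<^sub>1 p\<^sub>2 (W\<^sub>1::'x \<Rightarrow> 'y pmf) W\<^sub>2 (t::real).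
        S \<subseteq> \<X> \<and> set_pmf p = S \<and> set_pmf p\<^sub>1 = S \<and> set_pmf p\<^sub>2 = S \<and>
        (\<forall>x\<in>\<X>. set_pmf (W\<^sub>1 x) \<subseteq> \<Y> \<and> set_pmf (W\<^sub>2 x) \<subseteq> \<Y>) \<and> t \<in> {0..1} \<longrightarrow>
        ereal_exp (maximal_leakage (channel_joint p (\<lambda>x. mix_pmf t (W\<^sub>1 x) (W\<^sub>2 x))) fst snd)
          \<le> ereal t * ereal_exp (maximal_leakage (channel_joint p\<^sub>1 W\<^sub>1) fst snd)
            + ereal (1 - t) * ereal_exp (maximal_leakage (channel_joint p\<^sub>2 W\<^sub>2) fst snd))
   \<and> (\<forall>(W::'x \<Rightarrow> 'y pmf) (p\<^sub>1::'x pmf) p\<^sub>2 (t::real).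
        (\<forall>x\<in>\<X>. set_pmf (W x) \<subseteq> \<Y>) \<and> set_pmf p\<^sub>1 \<subseteq> \<X> \<and> set_pmf p\<^sub>2 \<subseteq> \<X> \<and> t \<in> {0..1} \<longrightarrow>
        maximal_leakage (channel_joint (mix_pmf t p\<^sub>1 p\<^sub>2) W) fst snd
          \<ge> ereal t * maximal_leakage (channel_joint p\<^sub>1 W) fst snd
            + ereal (1 - t) * maximal_leakage (channel_joint p\<^sub>2 W) fst snd)"
proof (intro conjI)
  have finP: "finite (set_pmf P)"
    using assms by (meson finite_SigmaI finite_subset)
  have G: "1 \<le> leakage_sum P" by (rule leakage_sum_ge_1[OF finP])
  show "maximal_leakage P fst snd = 0 \<longleftrightarrow> P = pair_pmf (map_pmf fst P) (map_pmf snd P)"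
    using G by (simp add: maximal_leakage_pair finP zero_ereal_def flip: leakage_sum_eq_1_iff[OF finP])
  show "set_pmf (map_pmf fst P) = \<X> \<longrightarrow>
        (maximal_leakage P fst snd = ereal (ln (real (card \<X>))) \<longleftrightarrow>
         (\<exists>f. AE \<omega> in measure_pmf P. fst \<omega> = f (snd \<omega>)))"
  proof
    assume X: "set_pmf (map_pmf fst P) = \<X>"
    then have "card \<X> > 0"
      using assms(1) by (auto simp: card_gt_0_iff set_pmf_not_empty)
    then have "maximal_leakage P fst snd = ereal (ln (real (card \<X>)))
        \<longleftrightarrow> leakage_sum P = real (card \<X>)"
      using G by (simp add: maximal_leakage_pair finP)
    then show "maximal_leakage P fst snd = ereal (ln (real (card \<X>))) \<longleftrightarrow>
         (\<exists>f. AE \<omega> in measure_pmf P. fst \<omega> = f (snd \<omega>))"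
      using leakage_sum_eq_card_iff[OF finP] X by (simp add: AE_measure_pmf_iff)
  qed
  show "renyi_entropy_0 P fst = ln (real (card (set_pmf (map_pmf fst P))))"
    by (simp add: renyi_entropy_0_def)
  show "maximal_leakage P fst fst = ereal (renyi_entropy_0 P fst)"
  proof -
    let ?D = "map_pmf (\<lambda>\<omega>. (fst \<omega>, fst \<omega>)) P"
    have fin: "finite (set_pmf ?D)" using finP by simp
    \<comment> \<open>The equality case of determinism for the pair \<open>(X, X)\<close>, where the
      function is the identity.\<close>
    have "leakage_sum ?D = real (card (fst ` set_pmf ?D))"
      unfolding leakage_sum_eq_card_iff[OF fin] by (intro exI[of _ id]) auto
    also have "fst ` set_pmf ?D = fst ` set_pmf P" by (simp add: image_image)
    finally show ?thesis
      using maximal_leakage_eq[OF fin] by (simp add: renyi_entropy_0_def)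
  qed
  show "\<exists>Q :: (nat \<times> nat) pmf. finite (set_pmf Q) \<and>
      maximal_leakage Q fst snd \<noteq> maximal_leakage Q snd fst"
    by (rule maximal_leakage_asymmetric)
next
  show "\<forall>(n::nat) (R::'w pmf) (X::nat \<Rightarrow> 'w \<Rightarrow> 'a) (Y::nat \<Rightarrow> 'w \<Rightarrow> 'b)
         (A::nat \<Rightarrow> 'a set) (B::nat \<Rightarrow> 'b set).
        (\<forall>i\<in>{1..n}. finite (A i) \<and> finite (B i) \<and>
           (\<forall>\<omega>\<in>set_pmf R. X i \<omega> \<in> A i \<and> Y i \<omega> \<in> B i)) \<and>
        prob_space.indep_vars (measure_pmf R) (\<lambda>_. count_space UNIV)
          (\<lambda>i \<omega>. (X i \<omega>, Y i \<omega>)) {1..n} \<longrightarrow>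
        maximal_leakage R (\<lambda>\<omega>. \<lambda>i\<in>{1..n}. X i \<omega>) (\<lambda>\<omega>. \<lambda>i\<in>{1..n}. Y i \<omega>)
          = (\<Sum>i=1..n. maximal_leakage R (X i) (Y i))"
  proof (intro allI impI, elim conjE)
    fix n :: nat and R :: "'w pmf" and X :: "nat \<Rightarrow> 'w \<Rightarrow> 'a" and Y :: "nat \<Rightarrow> 'w \<Rightarrow> 'b"
      and A :: "nat \<Rightarrow> 'a set" and B :: "nat \<Rightarrow> 'b set"
    let ?P = "\<lambda>i. map_pmf (\<lambda>\<omega>. (X i \<omega>, Y i \<omega>)) R"
    assume AB: "\<forall>i\<in>{1..n}. finite (A i) \<and> finite (B i) \<and>
           (\<forall>\<omega>\<in>set_pmf R. X i \<omega> \<in> A i \<and> Y i \<omega> \<in> B i)"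
      and ind: "prob_space.indep_vars (measure_pmf R) (\<lambda>_. count_space UNIV)
          (\<lambda>i \<omega>. (X i \<omega>, Y i \<omega>)) {1..n}"
    have fin: "finite (set_pmf (?P i))" if "i \<in> {1..n}" for i
      using AB that by (intro finite_subset[of "set_pmf (?P i)" "A i \<times> B i"]) auto
    have pos: "leakage_sum (?P i) \<noteq> 0" if "i \<in> {1..n}" for i
      using leakage_sum_ge_1[OF fin[OF that]] by linarith
    note J = leakage_sum_indep[OF finite_atLeastAtMost fin ind]
    have "maximal_leakage R (\<lambda>\<omega>. \<lambda>i\<in>{1..n}. X i \<omega>) (\<lambda>\<omega>. \<lambda>i\<in>{1..n}. Y i \<omega>)
        = ereal (ln (\<Prod>i=1..n. leakage_sum (?P i)))"
      by (subst maximal_leakage_eq[OF J(1)]) (simp_all only: J(2))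
    also have "\<dots> = ereal (\<Sum>i=1..n. ln (leakage_sum (?P i)))"
      by (intro arg_cong[where f = ereal] ln_prod pos finite_atLeastAtMost)
    also have "\<dots> = (\<Sum>i=1..n. maximal_leakage R (X i) (Y i))"
      unfolding sum_ereal[symmetric] by (intro sum.cong refl maximal_leakage_eq[OF fin, symmetric])
    finally show "maximal_leakage R (\<lambda>\<omega>. \<lambda>i\<in>{1..n}. X i \<omega>) (\<lambda>\<omega>. \<lambda>i\<in>{1..n}. Y i \<omega>)
          = (\<Sum>i=1..n. maximal_leakage R (X i) (Y i))" .
  qed
next
  show "\<forall>(S::'x set) (p::'x pmf) p\<^sub>1 p\<^sub>2 (W\<^sub>1::'x \<Rightarrow> 'y pmf) W\<^sub>2 (t::real).
        S \<subseteq> \<X> \<and> set_pmf p = S \<and> set_pmf p\<^sub>1 = S \<and> set_pmf p\<^sub>2 = S \<and>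
        (\<forall>x\<in>\<X>. set_pmf (W\<^sub>1 x) \<subseteq> \<Y> \<and> set_pmf (W\<^sub>2 x) \<subseteq> \<Y>) \<and> t \<in> {0..1} \<longrightarrow>
        ereal_exp (maximal_leakage (channel_joint p (\<lambda>x. mix_pmf t (W\<^sub>1 x) (W\<^sub>2 x))) fst snd)
          \<le> ereal t * ereal_exp (maximal_leakage (channel_joint p\<^sub>1 W\<^sub>1) fst snd)
            + ereal (1 - t) * ereal_exp (maximal_leakage (channel_joint p\<^sub>2 W\<^sub>2) fst snd)"
  proof (intro allI impI, elim conjE)
    fix S :: "'x set" and p p\<^sub>1 p\<^sub>2 :: "'x pmf" and W\<^sub>1 W\<^sub>2 :: "'x \<Rightarrow> 'y pmf" and t :: real
    assume S: "S \<subseteq> \<X>" "set_pmf p = S" "set_pmf p\<^sub>1 = S" "set_pmf p\<^sub>2 = S"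
      and W: "\<forall>x\<in>\<X>. set_pmf (W\<^sub>1 x) \<subseteq> \<Y> \<and> set_pmf (W\<^sub>2 x) \<subseteq> \<Y>" and t: "t \<in> {0..1}"
    have finS: "finite S" "S \<noteq> {}"
      using finite_subset[OF S(1) assms(1)] S(2) set_pmf_not_empty[of p] by auto
    let ?M = "\<lambda>W. \<Sum>y\<in>\<Y>. MAX x\<in>S. pmf (W x) y"
    \<comment> \<open>The right-hand side does not mention \<open>q\<close>, so the three input laws
      may differ as long as they share the support \<open>S\<close>.\<close>
    have exp_eq: "ereal_exp (maximal_leakage (channel_joint q W) fst snd) = ereal (?M W)"
      if "set_pmf q = S" "\<And>x. x \<in> S \<Longrightarrow> set_pmf (W x) \<subseteq> \<Y>" for q :: "'x pmf" and W :: "'x \<Rightarrow> 'y pmf"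
      using maximal_leakage_channel_joint[of q \<Y> W] that finS assms(2) by (simp add: ereal_exp_ln)
    \<comment> \<open>For each \<open>y\<close>, the maximum of a convex combination is at most the
      combination of the maxima.\<close>
    have "?M (\<lambda>x. mix_pmf t (W\<^sub>1 x) (W\<^sub>2 x))
        \<le> (\<Sum>y\<in>\<Y>. t * (MAX x\<in>S. pmf (W\<^sub>1 x) y) + (1 - t) * (MAX x\<in>S. pmf (W\<^sub>2 x) y))"
      using finS t by (intro sum_mono Max.boundedI)
        (auto simp: pmf_mix_pmf intro!: add_mono mult_left_mono)
    also have "\<dots> = t * ?M W\<^sub>1 + (1 - t) * ?M W\<^sub>2"
      by (simp add: sum.distrib sum_distrib_left)
    finally have "ereal (?M (\<lambda>x. mix_pmf t (W\<^sub>1 x) (W\<^sub>2 x)))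
        \<le> ereal t * ereal (?M W\<^sub>1) + ereal (1 - t) * ereal (?M W\<^sub>2)"
      by simp
    moreover have "set_pmf (mix_pmf t (W\<^sub>1 x) (W\<^sub>2 x)) \<subseteq> \<Y>" if "x \<in> S" for x
      using that S(1) W by (fastforce simp: mix_pmf_def split: if_splits)
    ultimately show "ereal_exp (maximal_leakage (channel_joint p (\<lambda>x. mix_pmf t (W\<^sub>1 x) (W\<^sub>2 x))) fst snd)
          \<le> ereal t * ereal_exp (maximal_leakage (channel_joint p\<^sub>1 W\<^sub>1) fst snd)
            + ereal (1 - t) * ereal_exp (maximal_leakage (channel_joint p\<^sub>2 W\<^sub>2) fst snd)"
      using S W by (subst (1 2 3) exp_eq) auto
  qed
next
  show "\<forall>(W::'x \<Rightarrow> 'y pmf) (p\<^sub>1::'x pmf) p\<^sub>2 (t::real).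
        (\<forall>x\<in>\<X>. set_pmf (W x) \<subseteq> \<Y>) \<and> set_pmf p\<^sub>1 \<subseteq> \<X> \<and> set_pmf p\<^sub>2 \<subseteq> \<X> \<and> t \<in> {0..1} \<longrightarrow>
        maximal_leakage (channel_joint (mix_pmf t p\<^sub>1 p\<^sub>2) W) fst snd
          \<ge> ereal t * maximal_leakage (channel_joint p\<^sub>1 W) fst snd
            + ereal (1 - t) * maximal_leakage (channel_joint p\<^sub>2 W) fst snd"
  proof (intro allI impI, elim conjE)
    fix W :: "'x \<Rightarrow> 'y pmf" and p\<^sub>1 p\<^sub>2 :: "'x pmf" and t :: real
    assume W: "\<forall>x\<in>\<X>. set_pmf (W x) \<subseteq> \<Y>" and p: "set_pmf p\<^sub>1 \<subseteq> \<X>" "set_pmf p\<^sub>2 \<subseteq> \<X>"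
      and t: "t \<in> {0..1}"
    let ?q = "mix_pmf t p\<^sub>1 p\<^sub>2"
    let ?M = "\<lambda>p. \<Sum>y\<in>\<Y>. MAX x\<in>set_pmf p. pmf (W x) y"
    have eq: "maximal_leakage (channel_joint p W) fst snd = ereal (ln (?M p))"
      and ge: "1 \<le> ?M p" if "set_pmf p \<subseteq> \<X>" for p
      using maximal_leakage_channel_joint[of p \<Y> W] that W assms(2) finite_subset[OF that assms(1)] by auto
    have q: "set_pmf ?q \<subseteq> \<X>"
      using p by (auto simp: mix_pmf_def split: if_splits)
    \<comment> \<open>Concavity reduces to monotonicity: a larger support gives larger maxima, and
      the mixture has the larger support.\<close>
    have mono: "ln (?M p) \<le> ln (?M ?q)" if "set_pmf p \<subseteq> set_pmf ?q" for p
    proof -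
      have "?M p \<le> ?M ?q"
        using that assms(1) q by (intro sum_mono Max_mono)
          (auto simp: set_pmf_not_empty intro: finite_subset)
      moreover have "1 \<le> ?M p" using ge that q by blast
      ultimately show ?thesis by simp
    qed
    \<comment> \<open>For \<open>0 < t < 1\<close> the mixture has the union of the two supports. At
      an endpoint one of them may be lost, but the corresponding term then has weight zero, whence
      the case distinctions below.\<close>
    have set_q: "x \<in> set_pmf ?q \<longleftrightarrow> t \<noteq> 0 \<and> x \<in> set_pmf p\<^sub>1 \<or> t \<noteq> 1 \<and> x \<in> set_pmf p\<^sub>2" for x
      using t by (auto simp: set_pmf_iff pmf_mix_pmf add_nonneg_eq_0_iff)
    have "t * ln (?M p\<^sub>1) \<le> t * ln (?M ?q)"
    proof (cases "t = 0")
      case False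
      then show ?thesis using t set_q by (intro mult_left_mono mono) auto
    qed simp
    moreover have "(1 - t) * ln (?M p\<^sub>2) \<le> (1 - t) * ln (?M ?q)"
    proof (cases "t = 1")
      case False
      then show ?thesis using t set_q by (intro mult_left_mono mono) auto
    qed simp
    ultimately have "t * ln (?M p\<^sub>1) + (1 - t) * ln (?M p\<^sub>2) \<le> ln (?M ?q)"
      by (simp add: algebra_simps)
    then show "maximal_leakage (channel_joint ?q W) fst snd
          \<ge> ereal t * maximal_leakage (channel_joint p\<^sub>1 W) fst snd
            + ereal (1 - t) * maximal_leakage (channel_joint p\<^sub>2 W) fst snd"
      by (simp add: eq p q)
  qed
qed

end
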